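(* Let $n\ge 4$ be an even number. Then there exist a combined base graph $X$ on $n/2$ vertices (loops and multiple edges allowed) and a combined voltage assignment $(\alpha,\omega)$ on $X$ in the group $\mathbb{Z}_n$ such that the token graph $F_2(K_n)$ is isomorphic to the covering graph $X^{(\alpha,\omega)}$.
   Context: Token graph: for a finite, undirected, simple graph $Y$ with $n$ vertices and an integer $1\le k\le n-1$, the $k$-token graph $F_k(Y)$ is the graph whose vertices are the $k$-element subsets of $V(Y)$, two of them being adjacent when their symmetric difference is (the vertex pair of) an edge of $Y$. $K_n$ denotes the complete graph on $n$ vertices, so $F_2(K_n)$ has the 2-subsets of an $n$-set as vertices, two being adjacent when they share exactly one element. For a group $G$ and a subgroup $H<G$ (subgroups may be trivial or improper), $G/H$ denotes the set of right cosets of $H$ in $G$. Combined voltage assignment: let $X$ be a finite graph, possibly with loops and multiple edges, and let $G$ be a group. A combined voltage assignment on $X$ in $G$ is a pair of functions $(\alpha,\omega)$, where $\alpha:E(X)\to G$ is a voltage assignment (each edge, including each loop and each one of several parallel edges, receives its own voltage; an edge written $xy$ with voltage $\alpha(xy)$ is regarded as oriented from $x$ to $y$ for the purpose of the voltage), and $\omega$ is a map that sends each vertex $x\in V(X)$ to a subgroup $\omega(x)<G$. A graph $X$ equipped with a combined voltage assignment in some group is called a combined base graph. Covering graph: the covering graph $X^{(\alpha,\omega)}$ of the combined base graph $X$ with respect to $G$ is the graph with vertex set $$V^{(\alpha,\omega)}=\{(x,K)\mid x\in V(X),\ K\in G/\omega(x)\},$$ whose edges are as follows: for each edge $xy\in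 E(X)$ with assigned voltage $\alpha(xy)\in G$, there is an edge from a vertex $(x,K)$, $K\in G/\omega(x)$, to a vertex $(y,H)$, $H\in G/\omega(y)$, if and only if $K\alpha(xy)\cap H\neq\emptyset$. (For $G=\mathbb{Z}_n$, written additively, $K\alpha(xy)$ is the translate $K+\alpha(xy)$.) For the isomorphism with $F_2(K_n)$, the covering graph is regarded as an undirected graph. *)

theory Defs
  imports "HOL-Algebra.Elementary_Groups" "Graph_Theory.Digraph"
begin

text \<open>
  Undirected multigraphs: an edge has a set of one (for a loop) or two ends, and different
  edges may have the same ends. A simple graph is given by taking the edges to be the pairs of
  adjacent vertices themselves, with \<open>id\<close> as end map.
\<close>

record ('v, 'e) multigraph =
  mverts :: "'v set"
  medges :: "'e set"
  mends :: "'e \<Rightarrow> 'v set"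

definition multigraph_iso :: "('v, 'e) multigraph \<Rightarrow> ('w, 'f) multigraph \<Rightarrow> bool" where
  "multigraph_iso Y Z \<longleftrightarrow>
     (\<exists>f g. bij_betw f (mverts Y) (mverts Z) \<and> bij_betw g (medges Y) (medges Z) \<and>
        (\<forall>e\<in>medges Y. mends Z (g e) = f ` mends Y e))"

definition complete_graph :: "nat \<Rightarrow> (nat, nat set) multigraph" where
  "complete_graph n =
     \<lparr>mverts = {0..<n}, medges = {A. A \<subseteq> {0..<n} \<and> card A = 2}, mends = id\<rparr>"

definition token_graph :: "nat \<Rightarrow> ('v, 'e) multigraph \<Rightarrow> ('v set, 'v set set) multigraph" where
  "token_graph k Y =
     \<lparr>mverts = {A. A \<subseteq> mverts Y \<and> finite A \<and> card A = k},
      medges = {{A, B} |A B. A \<subseteq> mverts Y \<and> finite A \<and> card A = k \<and>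
                             B \<subseteq> mverts Y \<and> finite B \<and> card B = k \<and>
                             sym_diff A B \<in> mends Y ` medges Y},
      mends = id\<rparr>"

text \<open>
  The base graph is an undirected multigraph in which every edge carries one reference
  orientation, along which its voltage is read; that is, a finite digraph with loops and parallel
  arcs, having one arc for each edge.
\<close>

locale combined_base_graph = group \<Gamma> + fin_digraph X
  for \<Gamma> :: "('g, 'm) monoid_scheme" and X :: "('v, 'e) pre_digraph" +
  fixes \<alpha> :: "'e \<Rightarrow> 'g" and \<omega> :: "'v \<Rightarrow> 'g set"
  assumes voltage_closed: "e \<in> arcs X \<Longrightarrow> \<alpha> e \<in> carrier \<Gamma>"
    and subgroup_assigned: "x \<in> verts X \<Longrightarrow> subgroup (\<omega> x) \<Gamma>"

text \<open>
  The edges of the covering graph are triples \<open>(e, K, H)\<close>, so every edge \<open>e\<close> of the base graph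
  contributes its own edges and parallel edges are kept. The orientation inherited from \<open>e\<close> is
  forgotten.
\<close>

definition covering_graph ::
  "('g, 'm) monoid_scheme \<Rightarrow> ('v, 'e) pre_digraph \<Rightarrow> ('e \<Rightarrow> 'g) \<Rightarrow> ('v \<Rightarrow> 'g set) \<Rightarrow>
    ('v \<times> 'g set, 'e \<times> 'g set \<times> 'g set) multigraph" where
  "covering_graph \<Gamma> X \<alpha> \<omega> =
     \<lparr>mverts = {(x, K). x \<in> verts X \<and> K \<in> rcosets\<^bsub>\<Gamma>\<^esub> (\<omega> x)},
      medges = {(e, K, H). e \<in> arcs X \<and> K \<in> rcosets\<^bsub>\<Gamma>\<^esub> (\<omega> (tail X e)) \<and>
                           H \<in> rcosets\<^bsub>\<Gamma>\<^esub> (\<omega> (head X e)) \<and>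
                           (K #>\<^bsub>\<Gamma>\<^esub> \<alpha> e) \<inter> H \<noteq> {}},
      mends = (\<lambda>(e, K, H). {(tail X e, K), (head X e, H)})\<rparr>"

end

theory Submission
  imports Defs "HOL-Library.Nat_Bijection"
begin

text \<open>
  Label the vertices of \<open>K\<^sub>n\<close> by the residues modulo \<open>n\<close> and let \<open>\<int>\<^sub>n\<close> act on the token graph by
  translation. A vertex of the token graph is a chord \<open>{g, g + d}\<close> of the cycle of residues, and
  its orbit is determined by its length \<open>d\<close>, for which \<open>1 \<le> d \<le> n/2\<close>. So there are \<open>n/2\<close> orbits.
  A chord has trivial stabilizer unless it is a diameter, \<open>d = n/2\<close>, whose stabilizer is
  \<open>{0, n/2}\<close>; in each case the orbit is the set of cosets of the stabilizer. These lengths are the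
  vertices of the base graph, and the stabilizers are the subgroups \<open>\<omega>\<close>.

  An edge consists of two chords \<open>{t, t + b}\<close> and \<open>{t, t + c}\<close> with a single common end \<open>t\<close>.
  A translation that preserves the edge, even if it exchanges the two chords, fixes \<open>t\<close> and hence is
  trivial. So the action on edges is free, even at the diameters, and the edge orbits are given by
  the pairs \<open>b < c\<close> in \<open>{1..<n}\<close>. Each such pair is an edge of the base graph. Its voltage compares
  where the two chords start: a chord \<open>{t, t + b}\<close> with \<open>b \<le> n/2\<close> starts at \<open>t\<close>, whereas for
  \<open>b > n/2\<close> it is the chord of length \<open>n - b\<close> that starts at \<open>t + b\<close>.

  That these data recover the token graph is an instance of a criterion for arbitrary groups,
  \<open>multigraph_iso_covering_graphI\<close>: it suffices to parametrize the vertices of a multigraph by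
  pairs (orbit, group element) up to the subgroup \<open>\<omega>\<close>, and its edges bijectively by pairs (base edge,
  group element), compatibly with the ends. Its hypotheses are supplied by \<open>chord_eq_iff\<close> and
  \<open>mverts_token_graph_complete\<close> for the vertices, and by \<open>bij_betw_star\<close> for the edges. It also asks
  that the subgroups at the two ends of a base edge meet trivially, which holds because chords from a
  common end cannot both be diameters.
\<close>

section \<open>Recognizing covering graphs\<close>

text \<open>
  Two parametrizations by the same set that identify the same parameters have images in bijection.
  With this, the maps on vertices and on edges come from parametrizations and need no explicit
  formula.
\<close>

lemma same_kernel_bij:
  assumes "\<And>a b. \<lbrakk>a \<in> A; b \<in> A\<rbrakk> \<Longrightarrow> P a = P b \<longleftrightarrow> Q a = Q b"
  obtains f where "bij_betw f (P ` A) (Q ` A)" and "\<And>a. a \<in> A \<Longrightarrow> f (P a) = Q a"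
proof
  let ?f = "Q \<circ> inv_into A P"
  show f: "?f (P a) = Q a" if "a \<in> A" for a
    using assms[of "inv_into A P (P a)" a] that by (simp add: inv_into_into f_inv_into_f)
  have "inj_on ?f (P ` A)"
    by (intro inj_onI) (metis assms f imageE)
  moreover have "?f ` P ` A = Q ` A"
    using f by (force simp: image_image)
  ultimately show "bij_betw ?f (P ` A) (Q ` A)"
    unfolding bij_betw_def by blast
qed

context combined_base_graph
begin

lemma coset_eq_iff:
  assumes "x \<in> verts X" "g \<in> carrier \<Gamma>" "h \<in> carrier \<Gamma>"
  shows "\<omega> x #>\<^bsub>\<Gamma>\<^esub> g = \<omega> x #>\<^bsub>\<Gamma>\<^esub> h \<longleftrightarrow> h \<in> \<omega> x #>\<^bsub>\<Gamma>\<^esub> g"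
  using assms subgroup_assigned[of x] rcos_self[of h "\<omega> x"] repr_independence[of h "\<omega> x" g] by metis

lemma mverts_covering_graph:
  "mverts (covering_graph \<Gamma> X \<alpha> \<omega>) =
     (\<lambda>(x, g). (x, \<omega> x #>\<^bsub>\<Gamma>\<^esub> g)) ` (verts X \<times> carrier \<Gamma>)"
  by (auto simp: covering_graph_def RCOSETS_def)

text \<open>
  The common element \<open>k \<otimes> \<alpha> e\<close> of \<open>K #> \<alpha> e\<close> and \<open>H\<close> determines both cosets: \<open>k\<close> represents \<open>K\<close> and
  \<open>k \<otimes> \<alpha> e\<close> represents \<open>H\<close>. So the edges above \<open>e\<close> are parametrized by the group, although not
  injectively in general.
\<close>
lemma medges_covering_graph:
  "medges (covering_graph \<Gamma> X \<alpha> \<omega>) =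
     (\<lambda>(e, g). (e, \<omega> (tail X e) #>\<^bsub>\<Gamma>\<^esub> g, \<omega> (head X e) #>\<^bsub>\<Gamma>\<^esub> (g \<otimes>\<^bsub>\<Gamma>\<^esub> \<alpha> e))) `
       (arcs X \<times> carrier \<Gamma>)" (is "_ = ?R")
proof (intro subset_antisym subsetI)
  fix z assume "z \<in> medges (covering_graph \<Gamma> X \<alpha> \<omega>)"
  then obtain e K H where z: "z = (e, K, H)" "e \<in> arcs X" "K \<in> rcosets\<^bsub>\<Gamma>\<^esub> (\<omega> (tail X e))"
    "H \<in> rcosets\<^bsub>\<Gamma>\<^esub> (\<omega> (head X e))" "(K #>\<^bsub>\<Gamma>\<^esub> \<alpha> e) \<inter> H \<noteq> {}"
    by (auto simp: covering_graph_def)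
  then obtain k where k: "k \<in> K" "k \<otimes>\<^bsub>\<Gamma>\<^esub> \<alpha> e \<in> H"
    by (auto simp: r_coset_def)
  have sub: "subgroup (\<omega> (tail X e)) \<Gamma>" "subgroup (\<omega> (head X e)) \<Gamma>"
    using z(2) subgroup_assigned by auto
  obtain a where a: "a \<in> carrier \<Gamma>" "K = \<omega> (tail X e) #>\<^bsub>\<Gamma>\<^esub> a"
    using z(3) by (auto simp: RCOSETS_def)
  obtain b where b: "b \<in> carrier \<Gamma>" "H = \<omega> (head X e) #>\<^bsub>\<Gamma>\<^esub> b"
    using z(4) by (auto simp: RCOSETS_def)
  have "k \<in> carrier \<Gamma>"
    using k(1) a sub by (meson r_coset_subset_G subgroup.subset subsetD)
  moreover have "K = \<omega> (tail X e) #>\<^bsub>\<Gamma>\<^esub> k"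
    using repr_independence[OF _ a(1) sub(1)] k(1) a(2) by blast
  moreover have "H = \<omega> (head X e) #>\<^bsub>\<Gamma>\<^esub> (k \<otimes>\<^bsub>\<Gamma>\<^esub> \<alpha> e)"
    using repr_independence[OF _ b(1) sub(2)] k(2) b(2) by blast
  ultimately show "z \<in> ?R"
    using z by auto
next
  fix z assume "z \<in> ?R"
  then obtain e g where z: "e \<in> arcs X" "g \<in> carrier \<Gamma>"
    "z = (e, \<omega> (tail X e) #>\<^bsub>\<Gamma>\<^esub> g, \<omega> (head X e) #>\<^bsub>\<Gamma>\<^esub> (g \<otimes>\<^bsub>\<Gamma>\<^esub> \<alpha> e))"
    by auto
  have sub: "subgroup (\<omega> (tail X e)) \<Gamma>" "subgroup (\<omega> (head X e)) \<Gamma>"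
    using z(1) subgroup_assigned by auto
  have "g \<in> \<omega> (tail X e) #>\<^bsub>\<Gamma>\<^esub> g"
    using z sub by (simp add: rcos_self)
  moreover have "g \<otimes>\<^bsub>\<Gamma>\<^esub> \<alpha> e \<in> \<omega> (head X e) #>\<^bsub>\<Gamma>\<^esub> (g \<otimes>\<^bsub>\<Gamma>\<^esub> \<alpha> e)"
    using z sub voltage_closed by (simp add: rcos_self)
  ultimately show "z \<in> medges (covering_graph \<Gamma> X \<alpha> \<omega>)"
    using z voltage_closed by (fastforce simp: covering_graph_def RCOSETS_def r_coset_def)
qed

text \<open>
  Here \<open>p x\<close> lists the vertices above \<open>x\<close> and \<open>q e\<close> the edges above \<open>e\<close>. The assumption \<open>indep\<close> makes
  the parametrization of the edges of the covering graph injective: if \<open>g\<close> and \<open>g'\<close> yield the same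
  edge above \<open>e\<close>, then \<open>g' \<otimes> inv g\<close> lies in the subgroup at the tail of \<open>e\<close>, and since the voltage
  cancels, it also lies in the subgroup at the head.
\<close>
lemma multigraph_iso_covering_graphI:
  assumes verts: "mverts Y = (\<lambda>(x, g). p x g) ` (verts X \<times> carrier \<Gamma>)"
    and p_eq: "\<And>x x' g g'. \<lbrakk>x \<in> verts X; x' \<in> verts X; g \<in> carrier \<Gamma>; g' \<in> carrier \<Gamma>\<rbrakk>
                 \<Longrightarrow> p x g = p x' g' \<longleftrightarrow> x = x' \<and> g' \<in> \<omega> x #>\<^bsub>\<Gamma>\<^esub> g"
    and edges: "bij_betw (\<lambda>(e, g). q e g) (arcs X \<times> carrier \<Gamma>) (medges Y)"
    and ends: "\<And>e g. \<lbrakk>e \<in> arcs X; g \<in> carrier \<Gamma>\<rbrakk>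
                 \<Longrightarrow> mends Y (q e g) = {p (tail X e) g, p (head X e) (g \<otimes>\<^bsub>\<Gamma>\<^esub> \<alpha> e)}"
    and indep: "\<And>e. e \<in> arcs X \<Longrightarrow> \<omega> (tail X e) \<inter> \<omega> (head X e) \<subseteq> {\<one>\<^bsub>\<Gamma>\<^esub>}"
  shows "multigraph_iso Y (covering_graph \<Gamma> X \<alpha> \<omega>)"
proof -
  let ?P = "\<lambda>(x, g). (x, \<omega> x #>\<^bsub>\<Gamma>\<^esub> g)"
  let ?Q = "\<lambda>(e, g). (e, \<omega> (tail X e) #>\<^bsub>\<Gamma>\<^esub> g, \<omega> (head X e) #>\<^bsub>\<Gamma>\<^esub> (g \<otimes>\<^bsub>\<Gamma>\<^esub> \<alpha> e))"
  obtain f where f: "bij_betw f (mverts Y) (mverts (covering_graph \<Gamma> X \<alpha> \<omega>))"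
    and fp: "\<And>x g. \<lbrakk>x \<in> verts X; g \<in> carrier \<Gamma>\<rbrakk> \<Longrightarrow> f (p x g) = (x, \<omega> x #>\<^bsub>\<Gamma>\<^esub> g)"
  proof (rule same_kernel_bij[of "verts X \<times> carrier \<Gamma>" "\<lambda>(x, g). p x g" ?P])
    fix a b assume ab: "a \<in> verts X \<times> carrier \<Gamma>" "b \<in> verts X \<times> carrier \<Gamma>"
    obtain x g x' g' where "a = (x, g)" "b = (x', g')"
      by (cases a, cases b)
    then show "(\<lambda>(x, g). p x g) a = (\<lambda>(x, g). p x g) b \<longleftrightarrow> ?P a = ?P b"
      using ab p_eq[of x x' g g'] coset_eq_iff[of x g g'] by auto
  qed (use verts in \<open>auto simp: mverts_covering_graph\<close>)
  have Q_inj: "g = g'"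
    if e: "e \<in> arcs X" and g: "g \<in> carrier \<Gamma>" "g' \<in> carrier \<Gamma>" and eq: "?Q (e, g) = ?Q (e, g')"
    for e g g'
  proof -
    have sub: "subgroup (\<omega> (tail X e)) \<Gamma>" "subgroup (\<omega> (head X e)) \<Gamma>"
      using e subgroup_assigned by auto
    have "g' \<in> \<omega> (tail X e) #>\<^bsub>\<Gamma>\<^esub> g"
      using eq e g coset_eq_iff[of "tail X e" g g'] by simp
    then obtain u where u: "u \<in> \<omega> (tail X e)" "g' = u \<otimes>\<^bsub>\<Gamma>\<^esub> g"
      by (auto simp: r_coset_def)
    have "g' \<otimes>\<^bsub>\<Gamma>\<^esub> \<alpha> e \<in> \<omega> (head X e) #>\<^bsub>\<Gamma>\<^esub> (g \<otimes>\<^bsub>\<Gamma>\<^esub> \<alpha> e)"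
      using eq e g voltage_closed coset_eq_iff[of "head X e" "g \<otimes>\<^bsub>\<Gamma>\<^esub> \<alpha> e" "g' \<otimes>\<^bsub>\<Gamma>\<^esub> \<alpha> e"] by simp
    then obtain w where w: "w \<in> \<omega> (head X e)" "g' \<otimes>\<^bsub>\<Gamma>\<^esub> \<alpha> e = w \<otimes>\<^bsub>\<Gamma>\<^esub> (g \<otimes>\<^bsub>\<Gamma>\<^esub> \<alpha> e)"
      by (auto simp: r_coset_def)
    have carr: "u \<in> carrier \<Gamma>" "w \<in> carrier \<Gamma>"
      using u(1) w(1) sub by (auto dest: subgroup.mem_carrier)
    then have "u = w"
      using u(2) w(2) g e voltage_closed by (simp add: m_assoc)
    then show ?thesis
      using indep[OF e] u w g by auto
  qed
  obtain h where h: "bij_betw h (medges Y) (medges (covering_graph \<Gamma> X \<alpha> \<omega>))"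
    and hq: "\<And>e g. \<lbrakk>e \<in> arcs X; g \<in> carrier \<Gamma>\<rbrakk> \<Longrightarrow> h (q e g) = ?Q (e, g)"
  proof (rule same_kernel_bij[of "arcs X \<times> carrier \<Gamma>" "\<lambda>(e, g). q e g" ?Q])
    fix a b assume ab: "a \<in> arcs X \<times> carrier \<Gamma>" "b \<in> arcs X \<times> carrier \<Gamma>"
    have "inj_on ?Q (arcs X \<times> carrier \<Gamma>)"
    proof (rule inj_onI)
      fix y z assume y: "y \<in> arcs X \<times> carrier \<Gamma>" and z: "z \<in> arcs X \<times> carrier \<Gamma>" and eq: "?Q y = ?Q z"
      obtain e g e' g' where yz: "y = (e, g)" "z = (e', g')"
        by (cases y, cases z)
      moreover have "e = e'"
        using eq unfolding yz by simp
      ultimately show "y = z"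
        using y z eq Q_inj[of e g g'] by blast
    qed
    moreover have "inj_on (\<lambda>(e, g). q e g) (arcs X \<times> carrier \<Gamma>)"
      using edges by (rule bij_betw_imp_inj_on)
    ultimately show "(\<lambda>(e, g). q e g) a = (\<lambda>(e, g). q e g) b \<longleftrightarrow> ?Q a = ?Q b"
      by (simp only: inj_on_eq_iff[OF _ ab])
  qed (use edges in \<open>auto simp: medges_covering_graph bij_betw_def\<close>)
  have "mends (covering_graph \<Gamma> X \<alpha> \<omega>) (h y) = f ` mends Y y" if y: "y \<in> medges Y" for y
  proof -
    obtain e g where eg: "e \<in> arcs X" "g \<in> carrier \<Gamma>" "y = q e g"
      using y unfolding bij_betw_imp_surj_on[OF edges, symmetric] by auto
    then show ?thesis
      using voltage_closed by (simp add: hq ends fp) (simp add: covering_graph_def)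
  qed
  with f h show ?thesis
    unfolding multigraph_iso_def by blast
qed

end

section \<open>Chords of the cycle of residues\<close>

definition residue :: "nat \<Rightarrow> int \<Rightarrow> nat" where
  "residue n i = nat (i mod int n)"

definition chord :: "nat \<Rightarrow> int \<Rightarrow> int \<Rightarrow> nat set" where
  "chord n i j = {residue n i, residue n j}"

text \<open>
  For distinct nonzero \<open>b\<close> and \<open>c\<close> below \<open>n\<close>, this is a typical edge of the token graph.
\<close>
definition star :: "nat \<Rightarrow> int \<Rightarrow> nat \<Rightarrow> nat \<Rightarrow> nat set set" where
  "star n t b c = {chord n t (t + int b), chord n t (t + int c)}"

text \<open>
  The chord \<open>{t, t + b}\<close> can be read from either end, with length \<open>b\<close> or \<open>n - b\<close>. The shorter reading
  is chosen, and \<open>chord_start\<close> is the position, relative to \<open>t\<close>, of the end at which it begins.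
\<close>
definition chord_length :: "nat \<Rightarrow> nat \<Rightarrow> nat" where
  "chord_length n b = min b (n - b)"

definition chord_start :: "nat \<Rightarrow> nat \<Rightarrow> int" where
  "chord_start n b = (if 2 * b \<le> n then 0 else int b)"

definition chord_stabilizer :: "nat \<Rightarrow> nat \<Rightarrow> int set" where
  "chord_stabilizer n d = (if 2 * d = n then {0, int d} else {0})"

text \<open>
  The arcs are the pairs \<open>b < c\<close>, coded as numbers. The pair \<open>(b, c)\<close> stands for the orbit of the edge
  with chords \<open>{0, b}\<close> and \<open>{0, c}\<close>, so its ends are the lengths of these chords. Different pairs can
  have the same ends, and \<open>(b, n - b)\<close> gives a loop.
\<close>
definition chord_base_graph :: "nat \<Rightarrow> (nat, nat) pre_digraph" where
  "chord_base_graph n =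
     \<lparr>verts = {1..n div 2},
      arcs = prod_encode ` {(b, c). 1 \<le> b \<and> b < c \<and> c < n},
      tail = (\<lambda>e. chord_length n (fst (prod_decode e))),
      head = (\<lambda>e. chord_length n (snd (prod_decode e)))\<rparr>"

definition chord_voltage :: "nat \<Rightarrow> nat \<Rightarrow> int" where
  "chord_voltage n e =
     (chord_start n (snd (prod_decode e)) - chord_start n (fst (prod_decode e))) mod int n"

lemma residue_less: "n > 0 \<Longrightarrow> residue n i < n"
  by (simp add: residue_def nat_less_iff)

lemma residue_eq_iff: "n > 0 \<Longrightarrow> residue n i = residue n j \<longleftrightarrow> i mod int n = j mod int n"
  by (simp add: residue_def eq_nat_nat_iff)

lemma residue_of_nat: "u < n \<Longrightarrow> residue n (int u) = u"
  by (simp add: residue_def)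

lemma residue_add_eq_iff:
  assumes "b < n" "c < n"
  shows "residue n (t + int b) = residue n (t + int c) \<longleftrightarrow> b = c"
proof -
  have "(t + int b) mod int n = (t + int c) mod int n \<longleftrightarrow> int b mod int n = int c mod int n"
    by (simp add: mod_eq_dvd_iff)
  with assms show ?thesis
    by (simp add: residue_eq_iff)
qed

lemma residue_add_neq: "\<lbrakk>0 < b; b < n\<rbrakk> \<Longrightarrow> residue n t \<noteq> residue n (t + int b)"
  using residue_add_eq_iff[of 0 n b t] by simp

text \<open>
  The base point of a chord or a star matters only modulo \<open>n\<close>, so group elements can be computed with
  as plain integers.
\<close>
lemma residue_mod: "residue n (i mod int n + j) = residue n (i + j)"
  by (simp add: residue_def mod_add_left_eq)

lemma chord_mod: "chord n (i mod int n) (i mod int n + j) = chord n i (i + j)"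
  using residue_mod[of n i 0] by (simp add: chord_def residue_mod)

lemma star_mod: "star n (t mod int n) b c = star n t b c"
  by (simp add: star_def chord_mod)

lemma chord_start_length:
  assumes "b < n"
  shows "chord n (t + chord_start n b) (t + chord_start n b + int (chord_length n b)) =
         chord n t (t + int b)"
proof (cases "2 * b \<le> n")
  case False
  then have "t + chord_start n b + int (chord_length n b) = t + int n"
    using assms by (simp add: chord_start_def chord_length_def min_def)
  moreover have "residue n (t + int n) = residue n t"
    by (simp add: residue_def)
  ultimately show ?thesis
    using False by (simp only: chord_def) (simp add: chord_start_def insert_commute)
qed (use assms in \<open>auto simp: chord_start_def chord_length_def min_def\<close>)

lemma rcoset_chord_stabilizer:
  assumes "g \<in> carrier (integer_mod_group n)" "n > 0"
  shows "chord_stabilizer n d #>\<^bsub>integer_mod_group n\<^esub> g =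
           (if 2 * d = n then {g, (g + int d) mod int n} else {g})"
  using assms
  by (auto simp: chord_stabilizer_def r_coset_def carrier_integer_mod_group add.commute)

text \<open>
  Positions \<open>g + d\<close> with \<open>0 \<le> g < n\<close> and \<open>0 \<le> d < n\<close> differ by less than \<open>2 n\<close>. For such integers,
  congruence becomes a disjunction of linear equations.
\<close>
lemma residue_eq_iff_close:
  assumes "i < j + 2 * int n" "j < i + 2 * int n"
  shows "residue n i = residue n j \<longleftrightarrow> i = j \<or> i = j + int n \<or> j = i + int n"
proof
  assume "residue n i = residue n j"
  moreover have "n > 0" using assms by simp
  ultimately have "int n dvd i - j"
    by (simp add: residue_eq_iff mod_eq_dvd_iff)
  then obtain k where k: "i - j = int n * k" by blast
  then have "int n * k < int n * 2" "int n * (- 2) < int n * k"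
    using assms by linarith+
  then have "k < 2 \<and> - 2 < k"
    using \<open>n > 0\<close> mult_less_cancel_left_pos[of "int n"] of_nat_0_less_iff by blast
  then have "k = 0 \<or> k = 1 \<or> k = -1" by arith
  then show "i = j \<or> i = j + int n \<or> j = i + int n" using k by auto
qed (auto simp: residue_def)

text \<open>
  This computes orbits and stabilizers of chords. If \<open>{g, g + d} = {g', g' + d'}\<close> with \<open>g \<noteq> g'\<close>, then
  the ends are exchanged, so \<open>n\<close> divides \<open>d + d'\<close>; as neither length exceeds \<open>n/2\<close>, both chords are
  diameters and \<open>g' = g + n/2\<close> modulo \<open>n\<close>.
\<close>
lemma chord_eq_iff:
  assumes d: "1 \<le> d" "2 * d \<le> n" "1 \<le> d'" "2 * d' \<le> n"
    and g: "g \<in> carrier (integer_mod_group n)" "g' \<in> carrier (integer_mod_group n)"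
  shows "chord n g (g + int d) = chord n g' (g' + int d') \<longleftrightarrow>
           d = d' \<and> g' \<in> chord_stabilizer n d #>\<^bsub>integer_mod_group n\<^esub> g"
proof -
  have n: "n > 0" using d by simp
  then have g': "0 \<le> g" "g < int n" "0 \<le> g'" "g' < int n"
    using g by (auto simp: carrier_integer_mod_group)
  have d_int: "1 \<le> int d" "2 * int d \<le> int n" "1 \<le> int d'" "2 * int d' \<le> int n"
    using d by linarith+
  have coset: "g' \<in> chord_stabilizer n d #>\<^bsub>integer_mod_group n\<^esub> g \<longleftrightarrow>
      g' = g \<or> 2 * int d = int n \<and> residue n (g + int d) = residue n g'"
    using n g' by (auto simp: rcoset_chord_stabilizer[OF g(1)] residue_eq_iff)
  have residues: "residue n g = residue n g' \<longleftrightarrow> g = g' \<or> g = g' + int n \<or> g' = g + int n"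
    "residue n (g + int d) = residue n (g' + int d') \<longleftrightarrow>
       g + int d = g' + int d' \<or> g + int d = g' + int d' + int n \<or> g' + int d' = g + int d + int n"
    "residue n g = residue n (g' + int d') \<longleftrightarrow>
       g = g' + int d' \<or> g = g' + int d' + int n \<or> g' + int d' = g + int n"
    "residue n (g + int d) = residue n g' \<longleftrightarrow>
       g + int d = g' \<or> g + int d = g' + int n \<or> g' = g + int d + int n"
    by (rule residue_eq_iff_close; use d_int g' in linarith)+
  have "d = d' \<longleftrightarrow> int d = int d'" by simp
  then show ?thesis
    unfolding coset chord_def doubleton_eq_iff residues
    using d_int g' by (smt (verit))
qed

section \<open>Vertices and edges of the token graph\<close>

lemma mverts_token_graph_complete:
  assumes "n > 0"
  shows "mverts (token_graph 2 (complete_graph n)) =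
           (\<lambda>(d, g). chord n g (g + int d)) ` ({1..n div 2} \<times> carrier (integer_mod_group n))"
    (is "?L = ?R")
proof (intro subset_antisym subsetI)
  fix A assume "A \<in> ?L"
  then have "A \<subseteq> {0..<n}" "card A = 2"
    by (auto simp: token_graph_def complete_graph_def)
  then obtain i j where ij: "A = {i, j}" "i < j" "j < n"
    by (auto simp: card_2_iff) (metis insert_commute linorder_neqE_nat)
  let ?b = "j - i"
  let ?g = "(int i + chord_start n ?b) mod int n"
  have "A = chord n (int i) (int i + int ?b)"
    using ij by (simp add: chord_def residue_of_nat)
  also have "\<dots> = chord n ?g (?g + int (chord_length n ?b))"
    using ij by (simp add: chord_mod chord_start_length)
  finally have "A = chord n ?g (?g + int (chord_length n ?b))" .
  moreover have "chord_length n ?b \<in> {1..n div 2}"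
    using ij by (auto simp: chord_length_def)
  moreover have "?g \<in> carrier (integer_mod_group n)"
    using assms by (simp add: carrier_integer_mod_group)
  ultimately show "A \<in> ?R" by blast
next
  fix A assume "A \<in> ?R"
  then obtain d g where "A = chord n g (g + int d)" "1 \<le> d" "d \<le> n div 2" by auto
  then show "A \<in> ?L"
    using assms residue_add_neq[of d n g] residue_less[of n]
    by (auto simp: token_graph_def complete_graph_def chord_def)
qed

text \<open>
  Disjoint 2-subsets have a symmetric difference with four elements, and equal ones have an empty
  symmetric difference. So adjacent 2-subsets share exactly one element.
\<close>
lemma medges_token_graph_complete:
  "medges (token_graph 2 (complete_graph n)) =
     {{{t, u}, {t, v}} |t u v. t < n \<and> u < n \<and> v < n \<and> t \<noteq> u \<and> t \<noteq> v \<and> u \<noteq> v}" (is "?L = ?R")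
proof (intro subset_antisym subsetI)
  let ?adj = "\<lambda>A B. A \<subseteq> {0..<n} \<and> card A = 2 \<and> B \<subseteq> {0..<n} \<and> card B = 2 \<and> card (sym_diff A B) = 2"
  have L: "?L = {{A, B} |A B. ?adj A B}"
    unfolding token_graph_def complete_graph_def multigraph.simps image_id
    by (intro Collect_cong ex_cong1) (auto intro: finite_subset[OF _ finite_atLeastLessThan])
  {
    fix E assume "E \<in> ?L"
    then obtain A B where E: "E = {A, B}" "?adj A B"
      unfolding L by blast
    obtain a b where A: "A = {a, b}" "a \<noteq> b" using E(2) by (auto simp: card_2_iff)
    obtain c d where B: "B = {c, d}" "c \<noteq> d" using E(2) by (auto simp: card_2_iff)
    have "A \<inter> B \<noteq> {}"
    proof
      assume "A \<inter> B = {}"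
      then have "sym_diff A B = {a, b, c, d}" "card {a, b, c, d} = 4"
        using A B by auto
      with E(2) show False by simp
    qed
    then obtain t where t: "t \<in> A" "t \<in> B" by auto
    obtain u where u: "A = {t, u}" "t \<noteq> u" using A t by auto
    obtain v where v: "B = {t, v}" "t \<noteq> v" using B t by auto
    have "u \<noteq> v" using E(2) u v by auto
    then show "E \<in> ?R" using E u v by auto
  next
    fix E assume "E \<in> ?R"
    then obtain t u v where E: "E = {{t, u}, {t, v}}" "t < n" "u < n" "v < n"
      "t \<noteq> u" "t \<noteq> v" "u \<noteq> v"
      by blast
    have "sym_diff {t, u} {t, v} = {u, v}" using E by auto
    then have "?adj {t, u} {t, v}" using E by simp
    with E(1) show "E \<in> ?L" unfolding L by blast
  }
qed

text \<open>
  The common end is the intersection of the two sets and the other ends are the rest of their union,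
  whichever way the two sets are matched up.
\<close>
lemma two_chords_eqD:
  assumes "{{t, u}, {t, v}} = {{t', u'}, {t', v'}}"
    and "t \<noteq> u" "t \<noteq> v" "u \<noteq> v" "t' \<noteq> u'" "t' \<noteq> v'" "u' \<noteq> v'"
  shows "t = t'" and "{u, v} = {u', v'}"
proof -
  have "\<Inter>{{t, u}, {t, v}} = {t}" "\<Inter>{{t', u'}, {t', v'}} = {t'}"
    using assms(2-) by auto
  then show "t = t'"
    using assms(1) by simp
  have "\<Union>{{t, u}, {t, v}} - {t} = {u, v}" "\<Union>{{t', u'}, {t', v'}} - {t'} = {u', v'}"
    using assms(2-) by auto
  then show "{u, v} = {u', v'}"
    using assms(1) \<open>t = t'\<close> by metis
qed

text \<open>
  The action on edges is free, and the pairs \<open>b < c\<close> represent distinct orbits: a star determines its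
  centre \<open>t\<close>, and then the set \<open>{b, c}\<close> of the positions of its other ends relative to \<open>t\<close>.
\<close>
lemma star_eq_iff:
  assumes bc: "1 \<le> b" "b < c" "c < n" and bc': "1 \<le> b'" "b' < c'" "c' < n"
  shows "star n t b c = star n t' b' c' \<longleftrightarrow> t mod int n = t' mod int n \<and> b = b' \<and> c = c'"
proof
  assume eq: "star n t b c = star n t' b' c'"
  let ?r = "residue n"
  have "?r t \<noteq> ?r (t + int b)" "?r t \<noteq> ?r (t + int c)" "?r (t + int b) \<noteq> ?r (t + int c)"
    "?r t' \<noteq> ?r (t' + int b')" "?r t' \<noteq> ?r (t' + int c')" "?r (t' + int b') \<noteq> ?r (t' + int c')"
    using bc bc' by (auto simp: residue_add_neq residue_add_eq_iff)
  with eq have t: "?r t = ?r t'" and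
    uv: "{?r (t + int b), ?r (t + int c)} = {?r (t' + int b'), ?r (t' + int c')}"
    using two_chords_eqD unfolding star_def chord_def by metis+
  have t_mod: "t mod int n = t' mod int n"
    using t bc by (simp add: residue_eq_iff)
  then have "?r (t' + int d) = ?r (t + int d)" for d
    by (metis residue_mod)
  with uv have "{?r (t + int b), ?r (t + int c)} = {?r (t + int b'), ?r (t + int c')}"
    by simp
  then have "b = b' \<and> c = c'"
    using bc bc' by (auto simp: doubleton_eq_iff residue_add_eq_iff)
  with t_mod show "t mod int n = t' mod int n \<and> b = b' \<and> c = c'" by simp
next
  assume "t mod int n = t' mod int n \<and> b = b' \<and> c = c'"
  then show "star n t b c = star n t' b' c'"
    by (metis star_mod)
qed

lemma medges_token_graph_star:
  "medges (token_graph 2 (complete_graph n)) = {star n t b c |t b c. 1 \<le> b \<and> b < c \<and> c < n}"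
    (is "?L = ?R")
proof (intro subset_antisym subsetI)
  fix E assume "E \<in> ?L"
  then obtain t u v where E: "E = {{t, u}, {t, v}}" "t < n" "u < n" "v < n" "t \<noteq> u" "t \<noteq> v" "u \<noteq> v"
    unfolding medges_token_graph_complete by blast
  define b where "b = residue n (int u - int t)"
  define c where "c = residue n (int v - int t)"
  have step: "residue n (int t + int (residue n (int w - int t))) = w" if "w < n" for w
  proof -
    have "residue n (int t + int (residue n (int w - int t))) = residue n (int w)"
      using that by (simp add: residue_def mod_simps)
    with that show ?thesis by (simp add: residue_of_nat)
  qed
  have u: "residue n (int t + int b) = u" and v: "residue n (int t + int c) = v"
    and t: "residue n (int t) = t"
    using E step by (auto simp: b_def c_def residue_of_nat)
  have "b \<noteq> 0" "c \<noteq> 0" "b \<noteq> c"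
    using u v t E by auto
  moreover have "b < n" "c < n"
    using E by (auto simp: b_def c_def residue_less)
  moreover have "E = star n (int t) b c" "E = star n (int t) c b"
    using E(1) u v t by (auto simp: star_def chord_def)
  ultimately show "E \<in> ?R"
    by (cases b c rule: linorder_cases) (auto simp: Suc_le_eq)
next
  fix E assume "E \<in> ?R"
  then obtain t b c where E: "E = star n t b c" "1 \<le> b" "b < c" "c < n" by auto
  then show "E \<in> ?L"
    using residue_less[of n] residue_add_neq[of b n t] residue_add_neq[of c n t]
      residue_add_eq_iff[of b n c t]
    unfolding medges_token_graph_complete star_def chord_def
    by (intro CollectI exI[of _ "residue n t"] exI[of _ "residue n (t + int b)"]
          exI[of _ "residue n (t + int c)"]) simp
qed

text \<open>
  The group element \<open>g\<close> that parametrizes an edge is where its first chord starts, because the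
  criterion expects this chord to be \<open>{g, g + d}\<close> with \<open>d\<close> the tail of the arc. The centre of the
  star is therefore \<open>g\<close> minus the start of the first chord relative to the centre.
\<close>
lemma bij_betw_star:
  "bij_betw (\<lambda>(e, g). star n (g - chord_start n (fst (prod_decode e)))
                        (fst (prod_decode e)) (snd (prod_decode e)))
     (arcs (chord_base_graph n) \<times> carrier (integer_mod_group n))
     (medges (token_graph 2 (complete_graph n)))"
  (is "bij_betw ?q ?A _")
proof (rule bij_betw_imageI)
  show "inj_on ?q ?A"
  proof (rule inj_onI, clarify)
    fix e g e' g'
    assume e: "e \<in> arcs (chord_base_graph n)" "e' \<in> arcs (chord_base_graph n)"
      and g: "g \<in> carrier (integer_mod_group n)" "g' \<in> carrier (integer_mod_group n)"
      and eq: "star n (g - chord_start n (fst (prod_decode e))) (fst (prod_decode e)) (snd (prod_decode e)) =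
               star n (g' - chord_start n (fst (prod_decode e'))) (fst (prod_decode e')) (snd (prod_decode e'))"
    obtain b c where bc: "e = prod_encode (b, c)" "1 \<le> b" "b < c" "c < n"
      using e(1) by (auto simp: chord_base_graph_def)
    obtain b' c' where bc': "e' = prod_encode (b', c')" "1 \<le> b'" "b' < c'" "c' < n"
      using e(2) by (auto simp: chord_base_graph_def)
    have "b = b' \<and> c = c' \<and> (g - chord_start n b) mod int n = (g' - chord_start n b') mod int n"
      using eq bc bc' by (auto simp: star_eq_iff)
    then have "b = b'" "c = c'" "g mod int n = g' mod int n"
      by (force simp: mod_eq_dvd_iff)+
    then show "e = e' \<and> g = g'"
      using bc bc' g by (simp add: carrier_integer_mod_group)
  qed
next
  show "?q ` ?A = medges (token_graph 2 (complete_graph n))"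
  proof (intro subset_antisym subsetI)
    fix E assume "E \<in> ?q ` ?A"
    then show "E \<in> medges (token_graph 2 (complete_graph n))"
      unfolding medges_token_graph_star by (fastforce simp: chord_base_graph_def)
  next
    fix E assume "E \<in> medges (token_graph 2 (complete_graph n))"
    then obtain t b c where E: "E = star n t b c" "1 \<le> b" "b < c" "c < n"
      unfolding medges_token_graph_star by blast
    let ?g = "(t + chord_start n b) mod int n"
    have "star n (?g - chord_start n b) b c = star n t b c"
      by (subst (1 2) star_mod[symmetric]) (simp add: mod_simps)
    then have "E = ?q (prod_encode (b, c), ?g)"
      using E by simp
    moreover have "prod_encode (b, c) \<in> arcs (chord_base_graph n)"
      using E by (auto simp: chord_base_graph_def)
    moreover have "?g \<in> carrier (integer_mod_group n)"
      using E by (simp add: carrier_integer_mod_group)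
    ultimately show "E \<in> ?q ` ?A" by blast
  qed
qed

section \<open>The combined base graph\<close>

lemma subgroup_chord_stabilizer:
  assumes "n > 0"
  shows "subgroup (chord_stabilizer n d) (integer_mod_group n)"
proof -
  interpret group "integer_mod_group n" by simp
  show ?thesis
  proof (rule subgroupI)
    fix a assume "a \<in> chord_stabilizer n d"
    moreover have "(- int d) mod (2 * int d) = int d" if "d > 0"
      using that by (simp add: zmod_zminus1_eq_if)
    ultimately show "inv\<^bsub>integer_mod_group n\<^esub> a \<in> chord_stabilizer n d"
      using assms by (auto simp: chord_stabilizer_def carrier_integer_mod_group split: if_splits)
  qed (use assms in \<open>auto simp: chord_stabilizer_def carrier_integer_mod_group split: if_splits\<close>)
qed

lemma combined_base_graph_chord:
  assumes "n > 0"
  shows "combined_base_graph (integer_mod_group n) (chord_base_graph n) (chord_voltage n)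
           (chord_stabilizer n)"
proof -
  have "finite {(b, c). 1 \<le> b \<and> b < c \<and> c < n}"
    by (rule finite_subset[of _ "{..n} \<times> {..n}"]) auto
  then have "fin_digraph (chord_base_graph n)"
    by unfold_locales (auto simp: chord_base_graph_def chord_length_def)
  with assms show ?thesis
    by (intro combined_base_graph.intro combined_base_graph_axioms.intro)
       (auto simp: subgroup_chord_stabilizer chord_voltage_def carrier_integer_mod_group)
qed

theorem theorem3p1:
  fixes n :: nat
  assumes "n \<ge> 4" and "even n"
  shows "\<exists>(X :: (nat, nat) pre_digraph) (\<alpha> :: nat \<Rightarrow> int) (\<omega> :: nat \<Rightarrow> int set).
           combined_base_graph (integer_mod_group n) X \<alpha> \<omega> \<and>
           card (verts X) = n div 2 \<and>
           multigraph_iso (token_graph 2 (complete_graph n))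
             (covering_graph (integer_mod_group n) X \<alpha> \<omega>)"
proof (intro exI conjI)
  let ?G = "integer_mod_group n" and ?X = "chord_base_graph n"
  have n: "n > 0" using assms by simp
  interpret combined_base_graph ?G ?X "chord_voltage n" "chord_stabilizer n"
    using n by (rule combined_base_graph_chord)
  show "combined_base_graph ?G ?X (chord_voltage n) (chord_stabilizer n)"
    by (fact combined_base_graph_axioms)
  show "card (verts ?X) = n div 2"
    by (simp add: chord_base_graph_def)
  show "multigraph_iso (token_graph 2 (complete_graph n))
          (covering_graph ?G ?X (chord_voltage n) (chord_stabilizer n))"
  proof (rule multigraph_iso_covering_graphI[OF _ _ bij_betw_star])
    show "mverts (token_graph 2 (complete_graph n)) =
            (\<lambda>(d, g). chord n g (g + int d)) ` (verts ?X \<times> carrier ?G)"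
      using n by (simp add: mverts_token_graph_complete chord_base_graph_def)
  next
    fix d d' g g'
    assume "d \<in> verts ?X" "d' \<in> verts ?X" "g \<in> carrier ?G" "g' \<in> carrier ?G"
    then show "chord n g (g + int d) = chord n g' (g' + int d') \<longleftrightarrow>
                 d = d' \<and> g' \<in> chord_stabilizer n d #>\<^bsub>?G\<^esub> g"
      by (intro chord_eq_iff) (auto simp: chord_base_graph_def)
  next
    fix e g assume e: "e \<in> arcs ?X" and g: "g \<in> carrier ?G"
    obtain b c where bc: "e = prod_encode (b, c)" "1 \<le> b" "b < c" "c < n"
      using e by (auto simp: chord_base_graph_def)
    \<comment> \<open>\<open>?t\<close> is the centre of the star; its two chords start at \<open>g\<close> and \<open>?h\<close>.\<close>
    let ?t = "g - chord_start n b"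
    let ?h = "g \<otimes>\<^bsub>?G\<^esub> chord_voltage n e"
    have h: "?h = (?t + chord_start n c) mod int n"
      using bc by (simp add: chord_voltage_def mod_simps algebra_simps)
    have "chord n g (g + int (chord_length n b)) = chord n ?t (?t + int b)"
      using chord_start_length[of b n ?t] bc by simp
    moreover have "chord n ?h (?h + int (chord_length n c)) = chord n ?t (?t + int c)"
      unfolding h chord_mod using bc by (intro chord_start_length)
    ultimately show "mends (token_graph 2 (complete_graph n))
        (star n (g - chord_start n (fst (prod_decode e))) (fst (prod_decode e)) (snd (prod_decode e))) =
        {chord n g (g + int (tail ?X e)), chord n ?h (?h + int (head ?X e))}"
      using bc by (simp add: token_graph_def star_def chord_base_graph_def)
  next
    fix e assume "e \<in> arcs ?X"
    then obtain b c where bc: "e = prod_encode (b, c)" "b < c" "c < n"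
      by (auto simp: chord_base_graph_def)
    \<comment> \<open>Only \<open>n/2\<close> is the step of a diameter, so a star contains at most one diameter.\<close>
    then have "2 * chord_length n b \<noteq> n \<or> 2 * chord_length n c \<noteq> n"
      unfolding chord_length_def by linarith
    then show "chord_stabilizer n (tail ?X e) \<inter> chord_stabilizer n (head ?X e) \<subseteq> {\<one>\<^bsub>?G\<^esub>}"
      using bc(1) by (auto simp: chord_base_graph_def chord_stabilizer_def)
  qed
qed

end
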